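(* Let $m$ be a positive integer, $h>0$, and let $X$ be a discrete random variable, all of whose absolute moments exist, with $$P\left(X=\frac{ih}{m}\right)=\frac hm f\left(\frac{ih}{m}\right),\quad i\in\mathbb Z,\qquad f\left(\frac{ih}{m}\right)\ge0\ \ \forall i\in\mathbb Z,\qquad \sum_{i\in\mathbb Z}\frac hm f\left(\frac{ih}m\right)=1 .$$ For every nonnegative integer $n$ put $$a_n=\frac hm\sum_{s\in\mathbb Z}\left(\frac{sh}m\right)^n f\left(\frac{sh}m\right),\qquad \tilde a_n=\frac1m\sum_{j=0}^{m-1}\frac hm\sum_{s\in\mathbb Z}\left(\frac{sh}m-\frac{m-1-2j}{2m}h\right)^n f\left(\frac{sh}m\right).$$ Then for all nonnegative integers $n$ $$a_n=\sum_{k=0}^{\lceil n/2\rceil}\binom{n}{2k}\left(\frac{h}{2m}\right)^{2k}\frac1{2k+1}\sum_{j=0}^{n-2k}\binom{n-2k}{j}\left(2^{1-j}-1\right)B_j\,h^j\,\tilde a_{n-2k-j}.$$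
   Context: $\{B_j\}$ are the Bernoulli numbers, $\sum_{j\ge0}B_jt^j/j!=t/(e^t-1)$ (so $B_0=1$, $B_1=-1/2$). Conventions: $\binom{n}{2k}=0$ if $2k>n$, and an empty sum (such as the inner sum when $n-2k<0$) is $0$. *)

theory Defs
  imports "HOL-Probability.Probability" "HOL-Computational_Algebra.Formal_Power_Series"
begin

text \<open>
  Exponential generating function \<open>t / (e\<^sup>t - 1)\<close>, as a formal power series
  (here \<open>fps_exp 1 - 1\<close> has subdegree 1, so the quotient is the genuine one).
\<close>
definition bernoulli :: "nat \<Rightarrow> real" where
  "bernoulli j = fact j * fps_nth (fps_X / (fps_exp 1 - 1)) j"

lemma bernoulli_egf:
  "Abs_fps (\<lambda>j. bernoulli j / fact j) * (fps_exp 1 - 1) = (fps_X :: real fps)"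
proof -
  have 0: "fps_exp (1::real) - 1 \<noteq> 0"
    by (metis diff_numeral_special(9) eq_iff_diff_eq_0 fps_exp_0 fps_exp_eq_iff zero_neq_one)
  have nz: "fps_nth (fps_exp (1::real) - 1) 1 \<noteq> 0"
    by simp
  then have "subdegree (fps_exp (1::real) - 1) \<le> subdegree (fps_X :: real fps)"
    using subdegree_leI[OF nz] by simp
  with 0 have "(fps_exp (1::real) - 1) dvd fps_X"
    by (simp add: fps_dvd_iff)
  then have "fps_X / (fps_exp 1 - 1) * (fps_exp 1 - 1) = (fps_X :: real fps)"
    by simp
  moreover have "Abs_fps (\<lambda>j. bernoulli j / fact j) = fps_X / (fps_exp 1 - 1)"
    by (simp add: bernoulli_def fps_eq_iff)
  ultimately show ?thesis by simp
qed

lemma bernoulli_0: "bernoulli 0 = 1"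
  using arg_cong[OF bernoulli_egf, of "\<lambda>F. fps_nth F 1"]
  by (simp add: fps_mult_nth)

lemma bernoulli_1: "bernoulli 1 = - 1 / 2"
  using arg_cong[OF bernoulli_egf, of "\<lambda>F. fps_nth F 2"] bernoulli_0
  by (simp add: fps_mult_nth numeral_2_eq_2)

definition lattice_moment :: "nat \<Rightarrow> real \<Rightarrow> (real \<Rightarrow> real) \<Rightarrow> nat \<Rightarrow> real" where
  "lattice_moment m h f n =
     h / real m * (\<Sum>\<^sub>\<infinity>s\<in>(UNIV :: int set).
       (of_int s * h / real m) ^ n * f (of_int s * h / real m))"

definition grouped_moment :: "nat \<Rightarrow> real \<Rightarrow> (real \<Rightarrow> real) \<Rightarrow> nat \<Rightarrow> real" where
  "grouped_moment m h f n =
     1 / real m * (\<Sum>j<m. h / real m * (\<Sum>\<^sub>\<infinity>s\<in>(UNIV :: int set).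
       (of_int s * h / real m - (real m - 1 - 2 * real j) / (2 * real m) * h) ^ n
         * f (of_int s * h / real m)))"

end

theory Submission imports Defs begin

text \<open>
  The absolute moments of \<open>X\<close> make all lattice sums
  \<open>\<Sum>\<^sub>\<infinity>s. (s h / m + d)^p f (s h / m)\<close> converge
  (\<open>summable_on_atoms\<close>, \<open>summable_on_shifted_power\<close>).  Since both sides of the claim are then
  linear in these sums, it is enough to prove the identity for a single atom \<open>x\<close>, that is, to
  express \<open>x^n\<close> through the polynomials
  \<open>Q_p(x) = (1/m) \<Sum>j<m. (x - (m - 1 - 2j) h / (2m))^p\<close> (\<open>power_eq_sum_grouped_power\<close>).

  That identity is a product of three exponential generating functions.  With
  \<open>c = h / (2m)\<close> and \<open>S_a(t) = e\<^bsup>at\<^esup> - e\<^bsup>-at\<^esup> = 2 sinh (a t)\<close>, they are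

  \<^item> \<open>S_c / (2 c t)\<close>, with coefficients \<open>c\<^bsup>2k\<^esup> / (2k + 1)\<close> at even indices,
  \<^item> \<open>h t / S_(h/2)\<close>, with coefficients \<open>(2\<^bsup>1-j\<^esup> - 1) B_j h^j\<close>,
  \<^item> \<open>e\<^bsup>xt\<^esup> S_(h/2) / (m S_c)\<close>, with coefficients \<open>Q_p(x)\<close>: the shifts form an arithmetic
    progression with step \<open>2c\<close> that is symmetric about \<open>0\<close>, so the geometric sum telescopes.

  As \<open>h = 2 c m\<close>, everything cancels and the product is \<open>e\<^bsup>xt\<^esup>\<close>.
\<close>

section \<open>The three exponential generating functions\<close>

definition grouped_power :: "nat \<Rightarrow> real \<Rightarrow> real \<Rightarrow> nat \<Rightarrow> real" where
  "grouped_power m h x n =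
     1 / real m * (\<Sum>j<m. (x - (real m - 1 - 2 * real j) / (2 * real m) * h) ^ n)"

definition fps_sinh2 :: "real \<Rightarrow> real fps" where
  "fps_sinh2 a = fps_exp a - fps_exp (- a)"

lemma fps_sinh2_nonzero:
  assumes "a \<noteq> 0"
  shows "fps_sinh2 a \<noteq> 0"
proof
  assume "fps_sinh2 a = 0"
  then have "fps_nth (fps_sinh2 a) 1 = 0" by simp
  then show False using assms by (simp add: fps_sinh2_def)
qed

lemma fps_sinhc:
  "Abs_fps (\<lambda>i. if even i then c ^ i / real (i + 1) / fact i else 0) * (fps_const (2 * c) * fps_X)
     = fps_sinh2 c"
proof -
  define A where "A = Abs_fps (\<lambda>i. if even i then c ^ i / real (i + 1) / fact i else 0)"
  have "fps_const (2 * c) * (A * fps_X) = fps_sinh2 c"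
  proof (rule fps_ext)
    fix n
    show "fps_nth (fps_const (2 * c) * (A * fps_X)) n = fps_nth (fps_sinh2 c) n"
    proof (cases n)
      case (Suc k)
      have "2 * c * (c ^ k / real (k + 1) / fact k) = 2 * (c ^ Suc k / fact (Suc k))"
        by simp
      then show ?thesis
        by (cases "even k") (simp_all add: Suc A_def fps_sinh2_def algebra_simps)
    qed (simp add: fps_sinh2_def)
  qed
  then show ?thesis
    by (simp only: A_def ac_simps)
qed

text \<open>
  With \<open>G(u) = u / (e\<^bsup>u\<^esup> - 1)\<close>, the series is \<open>2 G(ht/2) - G(ht)\<close>; putting both fractions over
  \<open>e\<^bsup>ht\<^esup> - 1 = (e\<^bsup>ht/2\<^esup> - 1) (e\<^bsup>ht/2\<^esup> + 1)\<close> leaves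
  \<open>h t e\<^bsup>ht/2\<^esup> / (e\<^bsup>ht\<^esup> - 1)\<close>.
\<close>
lemma fps_central_bernoulli:
  assumes "h \<noteq> 0"
  shows "Abs_fps (\<lambda>j. (2 powi (1 - int j) - 1) * bernoulli j * h ^ j / fact j) * fps_sinh2 (h / 2)
     = fps_const h * fps_X"
proof -
  define G where "G = Abs_fps (\<lambda>j. bernoulli j / fact j)"
  have G: "(G oo (fps_const a * fps_X)) * (fps_exp a - 1) = fps_const a * fps_X" for a :: real
  proof -
    have "(G * (fps_exp 1 - 1)) oo (fps_const a * fps_X) = fps_X oo (fps_const a * fps_X)"
      using bernoulli_egf by (simp add: G_def)
    then show ?thesis
      by (simp add: fps_compose_mult_distrib fps_compose_sub_distrib)
  qed
  define B where "B = Abs_fps (\<lambda>j. (2 powi (1 - int j) - 1) * bernoulli j * h ^ j / fact j)"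
  define E where "E = fps_exp (h / 2)"
  have EE: "fps_exp h = E * E"
    by (simp add: E_def fps_exp_add_mult[symmetric])
  have EI: "E * fps_exp (- (h / 2)) = 1"
    by (simp add: E_def fps_exp_add_mult[symmetric])
  have B: "B = fps_const 2 * (G oo (fps_const (h / 2) * fps_X)) - (G oo (fps_const h * fps_X))"
    by (rule fps_ext, simp add: B_def G_def) (simp add: power_int_diff field_simps)
  have "B * fps_sinh2 (h / 2) * E = B * (E * E - 1)"
    using EI unfolding fps_sinh2_def E_def[symmetric] by (simp add: algebra_simps)
  also have "\<dots> = ((G oo (fps_const (h / 2) * fps_X)) * (E - 1)) * fps_const 2 * (E + 1)
                   - (G oo (fps_const h * fps_X)) * (E * E - 1)"
    unfolding B by (simp add: algebra_simps)
  also have "\<dots> = fps_const (h / 2) * fps_X * fps_const 2 * (E + 1) - fps_const h * fps_X"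
    using G[of "h / 2"] G[of h] unfolding EE E_def[symmetric] by simp
  also have "fps_const (h / 2) * fps_X * fps_const 2 = fps_const (h / 2) * fps_const 2 * fps_X"
    by (simp only: ac_simps)
  also have "fps_const (h / 2) * fps_const 2 = fps_const h"
    by simp
  also have "fps_const h * fps_X * (E + 1) - fps_const h * fps_X = fps_const h * fps_X * E"
    by (simp only: distrib_left mult_1_right add_diff_cancel_right')
  finally have "(B * fps_sinh2 (h / 2) - fps_const h * fps_X) * E = 0"
    by (simp add: algebra_simps)
  moreover have "E \<noteq> 0" using EI by auto
  ultimately show ?thesis unfolding B_def by simp
qed

lemma fps_grouped_power:
  assumes "m > 0"
  shows "Abs_fps (\<lambda>p. grouped_power m h x p / fact p) * (fps_const (real m) * fps_sinh2 (h / (2 * real m)))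
     = fps_exp x * fps_sinh2 (h / 2)"
proof -
  define c where "c = h / (2 * real m)"
  \<comment> \<open>The \<open>j\<close>-th node is the midpoint of \<open>y j\<close> and \<open>y (Suc j)\<close>, which are \<open>2 c\<close> apart, so
      multiplying its exponential by \<open>S_c\<close> gives a difference of consecutive terms.\<close>
  define y where "y j = x - real m * c + 2 * real j * c" for j
  have h: "h = 2 * real m * c"
    using assms by (simp add: c_def)
  have node: "x - (real m - 1 - 2 * real j) / (2 * real m) * h = y j + c" for j
    using assms by (simp add: h y_def field_simps)
  define C where "C = Abs_fps (\<lambda>p. grouped_power m h x p / fact p)"
  have "C * fps_const (real m) = (\<Sum>j<m. fps_exp (y j + c))"
  proof (rule fps_ext)
    fix n
    have "grouped_power m h x n = 1 / real m * (\<Sum>j<m. (y j + c) ^ n)"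
      by (simp only: grouped_power_def node)
    then have "fps_nth (C * fps_const (real m)) n = (\<Sum>j<m. (y j + c) ^ n) / fact n"
      using assms by (simp add: C_def)
    also have "\<dots> = fps_nth (\<Sum>j<m. fps_exp (y j + c)) n"
      by (simp add: fps_sum_nth sum_divide_distrib)
    finally show "fps_nth (C * fps_const (real m)) n = fps_nth (\<Sum>j<m. fps_exp (y j + c)) n" .
  qed
  then have "C * (fps_const (real m) * fps_sinh2 c) = (\<Sum>j<m. fps_exp (y j + c) * fps_sinh2 c)"
    by (simp only: mult.assoc[symmetric] sum_distrib_right)
  also have "\<dots> = (\<Sum>j<m. fps_exp (y (Suc j)) - fps_exp (y j))"
  proof (intro sum.cong refl)
    fix j
    have "y j + c + c = y (Suc j)" "y j + c + - c = y j"
      by (simp_all add: y_def algebra_simps)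
    then show "fps_exp (y j + c) * fps_sinh2 c = fps_exp (y (Suc j)) - fps_exp (y j)"
      by (simp only: fps_sinh2_def right_diff_distrib fps_exp_add_mult[symmetric])
  qed
  also have "\<dots> = fps_exp (y m) - fps_exp (y 0)"
    by (rule sum_lessThan_telescope[of "\<lambda>j. fps_exp (y j)"])
  also have "\<dots> = fps_exp x * fps_sinh2 (h / 2)"
  proof -
    have "x + h / 2 = y m" "x + - (h / 2) = y 0"
      by (simp_all add: y_def h)
    then show ?thesis
      by (simp only: fps_sinh2_def right_diff_distrib fps_exp_add_mult[symmetric])
  qed
  finally show ?thesis by (simp only: c_def C_def)
qed

section \<open>The identity for a single atom\<close>

lemma power_eq_sum_grouped_power:
  assumes "m > 0" and "h > 0"
  shows "x ^ n =
    (\<Sum>k = 0..nat \<lceil>real n / 2\<rceil>.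
       real (n choose (2 * k)) * (h / (2 * real m)) ^ (2 * k) * (1 / (2 * real k + 1)) *
       (\<Sum>j | 2 * k + j \<le> n.
          real ((n - 2 * k) choose j) * (2 powi (1 - int j) - 1) * bernoulli j * h ^ j
            * grouped_power m h x (n - 2 * k - j)))"
proof -
  define c where "c = h / (2 * real m)"
  define b where "b j = (2 powi (1 - int j) - 1) * bernoulli j * h ^ j" for j
  define q where "q = grouped_power m h x"
  define A where "A = Abs_fps (\<lambda>i. if even i then c ^ i / real (i + 1) / fact i else 0)"
  define B where "B = Abs_fps (\<lambda>j. b j / fact j)"
  define C where "C = Abs_fps (\<lambda>p. q p / fact p)"
  have h: "h = 2 * c * real m" and c: "c > 0"
    using assms by (simp_all add: c_def)
  have A: "A * (fps_const (2 * c) * fps_X) = fps_sinh2 c"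
    unfolding A_def by (rule fps_sinhc)
  have B: "B * fps_sinh2 (h / 2) = fps_const h * fps_X"
    using assms unfolding B_def b_def by (intro fps_central_bernoulli) simp
  have C: "C * (fps_const (real m) * fps_sinh2 c) = fps_exp x * fps_sinh2 (h / 2)"
    using assms unfolding C_def c_def q_def by (intro fps_grouped_power)
  have H: "fps_const h = fps_const (2 * c) * fps_const (real m)"
    by (simp add: h)
  define D where "D = fps_const h * fps_X * fps_sinh2 c * fps_sinh2 (h / 2)"
  have "D \<noteq> 0"
    using assms c by (simp add: D_def fps_sinh2_nonzero)
  moreover have "(A * (B * C)) * D = fps_exp x * D"
  proof -
    have "(A * (B * C)) * D = (A * (fps_const (2 * c) * fps_X)) * (B * fps_sinh2 (h / 2))
            * (C * (fps_const (real m) * fps_sinh2 c))"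
      unfolding D_def H by (simp only: ac_simps)
    also have "\<dots> = fps_exp x * D"
      unfolding A B C D_def by (simp only: ac_simps)
    finally show ?thesis .
  qed
  \<comment> \<open>Formal power series over a field have no zero divisors.\<close>
  ultimately have ABC: "A * (B * C) = fps_exp x"
    by simp
  have "x ^ n = fact n * fps_nth (A * (B * C)) n"
    by (simp add: ABC)
  also have "\<dots> = (\<Sum>i=0..n. fact n * (fps_nth A i * fps_nth (B * C) (n - i)))"
    by (simp add: fps_mult_nth sum_distrib_left)
  also have "\<dots> = (\<Sum>i | i \<le> n \<and> even i. fact n * (fps_nth A i * fps_nth (B * C) (n - i)))"
    by (intro sum.mono_neutral_right) (auto simp: A_def)
  also have "\<dots> = (\<Sum>k | 2 * k \<le> n.
       real (n choose (2 * k)) * c ^ (2 * k) * (1 / (2 * real k + 1)) *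
       (\<Sum>j | 2 * k + j \<le> n. real ((n - 2 * k) choose j) * b j * q (n - 2 * k - j)))"
  proof (rule sum.reindex_bij_witness[where i = "\<lambda>k. 2 * k" and j = "\<lambda>i. i div 2"])
    fix i assume "i \<in> {i. i \<le> n \<and> even i}"
    then have "even i" and "i \<le> n" by auto
    then obtain k where k: "i = 2 * k" and le: "2 * k \<le> n" by (metis evenE)
    have "fact (n - 2 * k) * fps_nth (B * C) (n - 2 * k)
        = (\<Sum>j=0..n - 2 * k. fact (n - 2 * k) * (b j / fact j * (q (n - 2 * k - j) / fact (n - 2 * k - j))))"
      by (simp add: fps_mult_nth sum_distrib_left B_def C_def)
    also have "\<dots> = (\<Sum>j=0..n - 2 * k. real ((n - 2 * k) choose j) * b j * q (n - 2 * k - j))"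
      by (intro sum.cong refl) (simp add: binomial_fact)
    also have "{0..n - 2 * k} = {j. 2 * k + j \<le> n}"
      using le by auto
    finally have BC: "(\<Sum>j | 2 * k + j \<le> n. real ((n - 2 * k) choose j) * b j * q (n - 2 * k - j))
        = fact (n - 2 * k) * fps_nth (B * C) (n - 2 * k)" ..
    have half: "i div 2 = k"
      using k by simp
    have choose: "real (n choose (2 * k)) = fact n / (fact (2 * k) * fact (n - 2 * k))"
      using le by (simp add: binomial_fact)
    show "real (n choose (2 * (i div 2))) * c ^ (2 * (i div 2)) * (1 / (2 * real (i div 2) + 1)) *
       (\<Sum>j | 2 * (i div 2) + j \<le> n.
          real ((n - 2 * (i div 2)) choose j) * b j * q (n - 2 * (i div 2) - j))
      = fact n * (fps_nth A i * fps_nth (B * C) (n - i))"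
      unfolding half BC choose by (simp add: k A_def ac_simps)
  qed auto
  also have "\<dots> = (\<Sum>k = 0..nat \<lceil>real n / 2\<rceil>.
       real (n choose (2 * k)) * c ^ (2 * k) * (1 / (2 * real k + 1)) *
       (\<Sum>j | 2 * k + j \<le> n. real ((n - 2 * k) choose j) * b j * q (n - 2 * k - j)))"
  proof (intro sum.mono_neutral_left)
    have "k \<le> nat \<lceil>real n / 2\<rceil>" if "2 * k \<le> n" for k
      using that by linarith
    then show "{k. 2 * k \<le> n} \<subseteq> {0..nat \<lceil>real n / 2\<rceil>}" by auto
  qed (auto simp: binomial_eq_0)
  finally show ?thesis
    by (simp only: c_def b_def q_def mult.assoc)
qed

section \<open>Convergence of the lattice sums\<close>

text \<open>
  The events \<open>X = x i\<close> are disjoint, so every finite sum of absolute values is the integral of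
  \<open>\<bar>g \<circ> X\<bar>\<close> over a measurable set and hence at most the full integral.
\<close>
lemma summable_on_atoms:
  fixes X :: "'a \<Rightarrow> real" and g :: "real \<Rightarrow> real" and x :: "'i \<Rightarrow> real"
  assumes X: "X \<in> borel_measurable M" and fin: "finite_measure M"
    and int: "integrable M (\<lambda>\<omega>. g (X \<omega>))" and inj: "inj x"
  shows "(\<lambda>i. g (x i) * measure M {\<omega> \<in> space M. X \<omega> = x i}) summable_on UNIV"
proof -
  interpret finite_measure M by fact
  define S where "S i = {\<omega> \<in> space M. X \<omega> = x i}" for i
  have S [measurable]: "S i \<in> sets M" for i
    using X unfolding S_def by measurable
  have absint: "integrable M (\<lambda>\<omega>. \<bar>g (X \<omega>)\<bar>)"
    using int by simp
  have bound: "(\<Sum>i\<in>F. \<bar>g (x i) * measure M (S i)\<bar>) \<le> (\<integral>\<omega>. \<bar>g (X \<omega>)\<bar> \<partial>M)" if F: "finite F" for F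
  proof -
    have atom: "\<bar>g (x i) * measure M (S i)\<bar> = (\<integral>\<omega>. \<bar>g (x i)\<bar> * indicator (S i) \<omega> \<partial>M)" for i
      by (simp add: abs_mult)
    have "(\<Sum>i\<in>F. \<bar>g (x i) * measure M (S i)\<bar>)
        = (\<integral>\<omega>. (\<Sum>i\<in>F. \<bar>g (x i)\<bar> * indicator (S i) \<omega>) \<partial>M)"
      unfolding atom by (subst Bochner_Integration.integral_sum) (auto simp: emeasure_eq_measure)
    also have "\<dots> \<le> (\<integral>\<omega>. \<bar>g (X \<omega>)\<bar> \<partial>M)"
    proof (rule integral_mono)
      show "integrable M (\<lambda>\<omega>. \<Sum>i\<in>F. \<bar>g (x i)\<bar> * indicator (S i) \<omega>)"
        by (auto simp: emeasure_eq_measure)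
      fix \<omega> assume "\<omega> \<in> space M"
      show "(\<Sum>i\<in>F. \<bar>g (x i)\<bar> * indicator (S i) \<omega>) \<le> \<bar>g (X \<omega>)\<bar>"
      proof (cases "\<exists>i\<in>F. X \<omega> = x i")
        case True
        then obtain i where i: "i \<in> F" "X \<omega> = x i" by blast
        have "(\<Sum>i'\<in>F. \<bar>g (x i')\<bar> * indicator (S i') \<omega>) = (\<Sum>i'\<in>{i}. \<bar>g (x i')\<bar> * indicator (S i') \<omega>)"
          using i inj F by (intro sum.mono_neutral_right) (auto simp: S_def indicator_def dest: injD)
        also have "\<dots> = \<bar>g (x i)\<bar> * indicator (S i) \<omega>"
          by (subst sum.insert) auto
        also have "\<dots> \<le> \<bar>g (X \<omega>)\<bar>"
          using i by (simp add: indicator_def)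
        finally show ?thesis .
      next
        case False
        then have "(\<Sum>i\<in>F. \<bar>g (x i)\<bar> * indicator (S i) \<omega>) = 0"
          by (intro sum.neutral) (auto simp: S_def indicator_def)
        then show ?thesis by simp
      qed
    qed (rule absint)
    finally show ?thesis .
  qed
  have "(\<lambda>i. \<bar>g (x i) * measure M (S i)\<bar>) summable_on UNIV"
    using bound by (intro nonneg_bdd_above_summable_on bdd_aboveI2) auto
  then have "(\<lambda>i. g (x i) * measure M (S i)) summable_on UNIV"
    by (subst summable_on_iff_abs_summable_on_real) (simp only: real_norm_def)
  then show ?thesis by (simp only: S_def)
qed

lemma has_sum_sum_finite:
  fixes F :: "'b \<Rightarrow> 'i \<Rightarrow> 'c :: topological_comm_monoid_add"
  assumes "finite I" and "\<And>k. k \<in> I \<Longrightarrow> (F k has_sum a k) A"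
  shows "((\<lambda>i. \<Sum>k\<in>I. F k i) has_sum (\<Sum>k\<in>I. a k)) A"
  using assms by (induction I rule: finite_induct) (auto intro: has_sum_add)

lemma summable_on_shifted_power:
  fixes x w :: "'i \<Rightarrow> real"
  assumes "\<And>r. (\<lambda>i. x i ^ r * w i) summable_on A"
  shows "(\<lambda>i. (x i + d) ^ p * w i) summable_on A"
proof -
  have eq: "(\<Sum>r\<le>p. (real (p choose r) * d ^ (p - r)) * (x i ^ r * w i)) = (x i + d) ^ p * w i" for i
    unfolding binomial_ring sum_distrib_right by (simp only: ac_simps)
  have "((\<lambda>i. \<Sum>r\<le>p. (real (p choose r) * d ^ (p - r)) * (x i ^ r * w i)) has_sum
      (\<Sum>r\<le>p. (real (p choose r) * d ^ (p - r)) * infsum (\<lambda>i. x i ^ r * w i) A)) A"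
    by (intro has_sum_sum_finite has_sum_cmult_right has_sum_infsum assms) simp
  then show ?thesis
    unfolding eq by (auto simp: summable_on_def)
qed

section \<open>Summation over the atoms\<close>

theorem mainTheorem4:
  fixes M :: "'a measure" and X :: "'a \<Rightarrow> real" and f :: "real \<Rightarrow> real"
    and m :: nat and h :: real
  assumes "m > 0" and "h > 0"
    and "prob_space M" and "X \<in> borel_measurable M"
    and "\<And>r::nat. integrable M (\<lambda>\<omega>. \<bar>X \<omega>\<bar> ^ r)"
    and "\<And>i::int. measure M {\<omega> \<in> space M. X \<omega> = of_int i * h / real m}
           = h / real m * f (of_int i * h / real m)"
    and "\<And>i::int. f (of_int i * h / real m) \<ge> 0"
    and "((\<lambda>i::int. h / real m * f (of_int i * h / real m)) has_sum 1) UNIV"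
  shows "\<forall>n::nat. lattice_moment m h f n =
    (\<Sum>k = 0..nat \<lceil>real n / 2\<rceil>.
       real (n choose (2 * k)) * (h / (2 * real m)) ^ (2 * k) * (1 / (2 * real k + 1)) *
       (\<Sum>j | 2 * k + j \<le> n.
          real ((n - 2 * k) choose j) * (2 powi (1 - int j) - 1) * bernoulli j * h ^ j
            * grouped_moment m h f (n - 2 * k - j)))"
proof
  fix n :: nat
  interpret prob_space M by fact
  define x where "x s = of_int s * h / real m" for s :: int
  define w where "w s = f (x s)" for s
  have inj: "inj x"
    using assms(1,2) by (auto simp: inj_def x_def)
  have mass: "measure M {\<omega> \<in> space M. X \<omega> = x s} = h / real m * w s" for s
    using assms(6)[of s] by (simp only: x_def w_def)
  have base: "(\<lambda>s. x s ^ r * w s) summable_on UNIV" for r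
  proof -
    have "integrable M (\<lambda>\<omega>. \<bar>X \<omega> ^ r\<bar>)"
      using assms(5)[of r] by (simp only: power_abs)
    then have "integrable M (\<lambda>\<omega>. X \<omega> ^ r)"
      using assms(4) by (subst (asm) integrable_abs_iff) auto
    then have "(\<lambda>s. x s ^ r * measure M {\<omega> \<in> space M. X \<omega> = x s}) summable_on UNIV"
      using assms(4) inj finite_measure_axioms by (intro summable_on_atoms[where g = "\<lambda>y. y ^ r"])
    then have "(\<lambda>s. h / real m * (x s ^ r * w s)) summable_on UNIV"
      unfolding mass by (simp only: ac_simps)
    then show ?thesis
      using assms(1,2) by (subst (asm) summable_on_cmult_right') auto
  qed
  have shifted: "(\<lambda>s. (x s - d) ^ p * w s) summable_on UNIV" for d p
    using summable_on_shifted_power[OF base, of "- d" p] by simp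
  define Q where "Q p = 1 / real m * (\<Sum>j<m. \<Sum>\<^sub>\<infinity>s.
      (x s - (real m - 1 - 2 * real j) / (2 * real m) * h) ^ p * w s)" for p
  have Q: "((\<lambda>s. grouped_power m h (x s) p * w s) has_sum Q p) UNIV" for p
  proof -
    have "((\<lambda>s. 1 / real m * (\<Sum>j<m.
        (x s - (real m - 1 - 2 * real j) / (2 * real m) * h) ^ p * w s)) has_sum Q p) UNIV"
      unfolding Q_def
      by (intro has_sum_cmult_right has_sum_sum_finite has_sum_infsum shifted) simp
    then show ?thesis
      by (simp only: grouped_power_def sum_distrib_right mult.assoc)
  qed
  have grouped: "grouped_moment m h f p = h / real m * Q p" for p
    by (simp add: grouped_moment_def Q_def x_def w_def sum_distrib_left ac_simps)
  define a where "a k = real (n choose (2 * k)) * (h / (2 * real m)) ^ (2 * k) * (1 / (2 * real k + 1))"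
    for k
  define b where "b k j = real ((n - 2 * k) choose j) * (2 powi (1 - int j) - 1) * bernoulli j * h ^ j"
    for k j
  have fin: "finite {j. 2 * k + j \<le> n}" for k
    by (rule finite_subset[of _ "{..n}"]) auto
  have "((\<lambda>s. \<Sum>k = 0..nat \<lceil>real n / 2\<rceil>. a k *
        (\<Sum>j | 2 * k + j \<le> n. b k j * (grouped_power m h (x s) (n - 2 * k - j) * w s)))
      has_sum (\<Sum>k = 0..nat \<lceil>real n / 2\<rceil>. a k * (\<Sum>j | 2 * k + j \<le> n. b k j * Q (n - 2 * k - j)))) UNIV"
    by (intro has_sum_sum_finite has_sum_cmult_right Q fin) simp
  moreover have "(\<Sum>k = 0..nat \<lceil>real n / 2\<rceil>. a k *
        (\<Sum>j | 2 * k + j \<le> n. b k j * (grouped_power m h (x s) (n - 2 * k - j) * w s)))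
      = x s ^ n * w s" for s
    using power_eq_sum_grouped_power[OF assms(1,2), of "x s" n]
    by (simp only: a_def b_def sum_distrib_right mult.assoc)
  ultimately have "(\<Sum>\<^sub>\<infinity>s. x s ^ n * w s)
      = (\<Sum>k = 0..nat \<lceil>real n / 2\<rceil>. a k * (\<Sum>j | 2 * k + j \<le> n. b k j * Q (n - 2 * k - j)))"
    by (simp add: infsumI)
  then have "lattice_moment m h f n = h / real m *
      (\<Sum>k = 0..nat \<lceil>real n / 2\<rceil>. a k * (\<Sum>j | 2 * k + j \<le> n. b k j * Q (n - 2 * k - j)))"
    by (simp only: lattice_moment_def x_def w_def)
  also have "\<dots> = (\<Sum>k = 0..nat \<lceil>real n / 2\<rceil>. a k *
      (\<Sum>j | 2 * k + j \<le> n. b k j * grouped_moment m h f (n - 2 * k - j)))"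
    by (simp only: grouped sum_distrib_left ac_simps)
  finally show "lattice_moment m h f n =
    (\<Sum>k = 0..nat \<lceil>real n / 2\<rceil>.
       real (n choose (2 * k)) * (h / (2 * real m)) ^ (2 * k) * (1 / (2 * real k + 1)) *
       (\<Sum>j | 2 * k + j \<le> n.
          real ((n - 2 * k) choose j) * (2 powi (1 - int j) - 1) * bernoulli j * h ^ j
            * grouped_moment m h f (n - 2 * k - j)))"
    by (simp only: a_def b_def)
qed

end
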